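(* The class of $\omega$-languages recognized by deterministic reachability-regular Parikh automata is a strict subclass of the class of $\omega$-languages recognized by deterministic weak reset Parikh automata.
   Context: $\mathbb{N}=\{0,1,2,\dots\}$. A linear set is a set $C(\mathbf{b},P)=\{\mathbf{b}+\mathbf{p}_1z_1+\dots+\mathbf{p}_\ell z_\ell \mid z_1,\dots,z_\ell\in\mathbb{N}\}\subseteq\mathbb{N}^d$ with $\mathbf{b}\in\mathbb{N}^d$ and $P=\{\mathbf{p}_1,\dots,\mathbf{p}_\ell\}\subseteq\mathbb{N}^d$ finite ($\ell\ge 0$); a semi-linear set is a finite union of linear sets. A Parikh automaton (PA) of dimension $d\ge 1$ is a tuple $\mathcal{A}=(Q,\Sigma,q_0,\Delta,F,C)$ with a finite state set $Q$, a finite non-empty alphabet $\Sigma$, an initial state $q_0\in Q$, a finite set of labeled transitions $\Delta\subseteq Q\times\Sigma\times\mathbb{N}^d\times Q$, a set of accepting states $F\subseteq Q$, and a semi-linear set $C\subseteq\mathbb{N}^d$. It is deterministic if for every $(p,a)\in Q\times\Sigma$ there is exactly one transition $(p,a,\mathbf{v},q)\in\Delta$. A run on $\alpha=\alpha_1\alpha_2\dots\in\Sigma^\omega$ is an infinite sequence $r=r_1r_2\dots$ with $r_i=(p_{i-1},\alpha_i,\mathbf{v}_i,p_i)\in\Delta$ and $p_0=q_0$; write $\rho(r_m\dots r_n)=\sum_{i=m}^n\mathbf{v}_i$. Acceptance of a run $r$: - Reachability-regular PA: there is $i\ge 1$ with $p_i\in F$ and $\rho(r_1\dots r_i)\in C$,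 and there are infinitely many $j\ge 1$ with $p_j\in F$. - Weak reset PA: there are infinitely many positions $0=k_0<k_1<k_2<\dots$ such that $p_{k_i}\in F$ and $\rho(r_{k_{i-1}+1}\dots r_{k_i})\in C$ for all $i\ge 1$. In each case the recognized $\omega$-language is the set of all $\alpha\in\Sigma^\omega$ on which there is an accepting run. *)

theory Defs
  imports "HOL-Library.Infinite_Typeclass"
begin

text \<open>
  The dimension varies from automaton to automaton, so a vector of dimension \<open>d\<close> is represented
  as a function on the naturals that vanishes from index \<open>d\<close> on; the coordinates are \<open>0, \<dots>, d - 1\<close>.
\<close>

type_synonym vector = "nat \<Rightarrow> nat"

definition vectors :: "nat \<Rightarrow> vector set" where
  "vectors d = {v. \<forall>j\<ge>d. v j = 0}"

definition linear_comb_set :: "vector \<Rightarrow> vector set \<Rightarrow> vector set" where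
  "linear_comb_set b P = {(\<lambda>j. b j + (\<Sum>p\<in>P. p j * z p)) | z :: vector \<Rightarrow> nat. True}"

definition linear_set :: "nat \<Rightarrow> vector set \<Rightarrow> bool" where
  "linear_set d L \<longleftrightarrow>
    (\<exists>b P. b \<in> vectors d \<and> finite P \<and> P \<subseteq> vectors d \<and> L = linear_comb_set b P)"

definition semilinear_set :: "nat \<Rightarrow> vector set \<Rightarrow> bool" where
  "semilinear_set d C \<longleftrightarrow> (\<exists>\<L>. finite \<L> \<and> (\<forall>L\<in>\<L>. linear_set d L) \<and> C = \<Union>\<L>)"

type_synonym ('q, 'a) transition = "'q \<times> 'a \<times> vector \<times> 'q"

abbreviation source :: "('q, 'a) transition \<Rightarrow> 'q" where
  "source t \<equiv> fst t"

abbreviation letter :: "('q, 'a) transition \<Rightarrow> 'a" where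
  "letter t \<equiv> fst (snd t)"

abbreviation label_vec :: "('q, 'a) transition \<Rightarrow> vector" where
  "label_vec t \<equiv> fst (snd (snd t))"

abbreviation target :: "('q, 'a) transition \<Rightarrow> 'q" where
  "target t \<equiv> snd (snd (snd t))"

record ('q, 'a) pa =
  dimension :: nat
  states :: "'q set"
  alphabet :: "'a set"
  initial :: 'q
  transitions :: "('q, 'a) transition set"
  accepting :: "'q set"
  constraint_set :: "vector set"

definition parikh_automaton :: "('q, 'a) pa \<Rightarrow> bool" where
  "parikh_automaton A \<longleftrightarrow>
    dimension A \<ge> 1 \<and>
    finite (states A) \<and>
    finite (alphabet A) \<and> alphabet A \<noteq> {} \<and>
    initial A \<in> states A \<and>
    finite (transitions A) \<and>
    transitions A \<subseteq> states A \<times> alphabet A \<times> vectors (dimension A) \<times> states A \<and>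
    accepting A \<subseteq> states A \<and>
    semilinear_set (dimension A) (constraint_set A)"

definition deterministic :: "('q, 'a) pa \<Rightarrow> bool" where
  "deterministic A \<longleftrightarrow>
    (\<forall>p\<in>states A. \<forall>a\<in>alphabet A. \<exists>!t. t \<in> transitions A \<and> source t = p \<and> letter t = a)"

text \<open>
  Words and runs are indexed from 0, so the informal \<open>\<alpha>\<^sub>i\<close> and \<open>r\<^sub>i\<close> (for \<open>i \<ge> 1\<close>) are
  \<open>\<alpha> (i - 1)\<close> and \<open>r (i - 1)\<close>. Positions keep their informal index: \<open>state_at r i\<close> is
  \<open>p\<^sub>i\<close>, the state after \<open>i\<close> transitions, and \<open>weight r m n\<close> is the sum over the
  transitions between the positions \<open>m\<close> and \<open>n\<close>, which is informally \<open>\<rho>(r\<^sub>m\<^sub>+\<^sub>1 \<dots> r\<^sub>n)\<close>.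
\<close>

definition is_run :: "('q, 'a) pa \<Rightarrow> (nat \<Rightarrow> 'a) \<Rightarrow> (nat \<Rightarrow> ('q, 'a) transition) \<Rightarrow> bool" where
  "is_run A \<alpha> r \<longleftrightarrow>
    (\<forall>i. r i \<in> transitions A \<and> letter (r i) = \<alpha> i) \<and>
    source (r 0) = initial A \<and>
    (\<forall>i. source (r (Suc i)) = target (r i))"

definition state_at :: "(nat \<Rightarrow> ('q, 'a) transition) \<Rightarrow> nat \<Rightarrow> 'q" where
  "state_at r i = (case i of 0 \<Rightarrow> source (r 0) | Suc j \<Rightarrow> target (r j))"

definition weight :: "(nat \<Rightarrow> ('q, 'a) transition) \<Rightarrow> nat \<Rightarrow> nat \<Rightarrow> vector" where
  "weight r m n = (\<lambda>j. \<Sum>i\<in>{m..<n}. label_vec (r i) j)"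

definition reach_reg_accepting ::
    "('q, 'a) pa \<Rightarrow> (nat \<Rightarrow> ('q, 'a) transition) \<Rightarrow> bool" where
  "reach_reg_accepting A r \<longleftrightarrow>
    (\<exists>i\<ge>1. state_at r i \<in> accepting A \<and> weight r 0 i \<in> constraint_set A) \<and>
    infinite {j. j \<ge> 1 \<and> state_at r j \<in> accepting A}"

definition weak_reset_accepting ::
    "('q, 'a) pa \<Rightarrow> (nat \<Rightarrow> ('q, 'a) transition) \<Rightarrow> bool" where
  "weak_reset_accepting A r \<longleftrightarrow>
    (\<exists>k :: nat \<Rightarrow> nat. k 0 = 0 \<and> strict_mono k \<and>
      (\<forall>i\<ge>1. state_at r (k i) \<in> accepting A \<and> weight r (k (i - 1)) (k i) \<in> constraint_set A))"

definition reach_reg_language :: "('q, 'a) pa \<Rightarrow> (nat \<Rightarrow> 'a) set" where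
  "reach_reg_language A =
    {\<alpha>. (\<forall>i. \<alpha> i \<in> alphabet A) \<and> (\<exists>r. is_run A \<alpha> r \<and> reach_reg_accepting A r)}"

definition weak_reset_language :: "('q, 'a) pa \<Rightarrow> (nat \<Rightarrow> 'a) set" where
  "weak_reset_language A =
    {\<alpha>. (\<forall>i. \<alpha> i \<in> alphabet A) \<and> (\<exists>r. is_run A \<alpha> r \<and> weak_reset_accepting A r)}"

text \<open>
  The alphabets range over the finite non-empty sets of letters of type \<open>'a\<close>. Since state sets
  are finite, taking the states from the naturals is no restriction; see
  \<open>reach_reg_language_in_class\<close> and \<open>weak_reset_language_in_class\<close> below.
\<close>

definition det_reach_reg_languages :: "(nat \<Rightarrow> 'a) set set" where
  "det_reach_reg_languages =
    {reach_reg_language A | A :: (nat, 'a) pa. parikh_automaton A \<and> deterministic A}"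

definition det_weak_reset_languages :: "(nat \<Rightarrow> 'a) set set" where
  "det_weak_reset_languages =
    {weak_reset_language A | A :: (nat, 'a) pa. parikh_automaton A \<and> deterministic A}"

definition rename_trans :: "('q \<Rightarrow> 's) \<Rightarrow> ('q, 'a) transition \<Rightarrow> ('s, 'a) transition" where
  "rename_trans f t = (f (source t), letter t, label_vec t, f (target t))"

definition rename_states :: "('q \<Rightarrow> 's) \<Rightarrow> ('q, 'a) pa \<Rightarrow> ('s, 'a) pa" where
  "rename_states f A =
    \<lparr>dimension = dimension A, states = f ` states A, alphabet = alphabet A, initial = f (initial A),
     transitions = rename_trans f ` transitions A, accepting = f ` accepting A,
     constraint_set = constraint_set A\<rparr>"

lemma rename_trans_sel [simp]:
  "source (rename_trans f t) = f (source t)"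
  "letter (rename_trans f t) = letter t"
  "label_vec (rename_trans f t) = label_vec t"
  "target (rename_trans f t) = f (target t)"
  by (simp_all add: rename_trans_def)

lemma rename_states_sel [simp]:
  "dimension (rename_states f A) = dimension A"
  "states (rename_states f A) = f ` states A"
  "alphabet (rename_states f A) = alphabet A"
  "initial (rename_states f A) = f (initial A)"
  "transitions (rename_states f A) = rename_trans f ` transitions A"
  "accepting (rename_states f A) = f ` accepting A"
  "constraint_set (rename_states f A) = constraint_set A"
  by (simp_all add: rename_states_def)

lemma parikh_automaton_transD:
  assumes "parikh_automaton A" "t \<in> transitions A"
  shows "source t \<in> states A" "letter t \<in> alphabet A"
    "label_vec t \<in> vectors (dimension A)" "target t \<in> states A"
  using assms by (auto simp: parikh_automaton_def)

lemma parikh_automaton_rename_states: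
  assumes A: "parikh_automaton A"
  shows "parikh_automaton (rename_states f A)"
  using A parikh_automaton_transD[OF A]
  by (auto simp: parikh_automaton_def rename_trans_def)

lemma deterministic_rename_states:
  assumes A: "parikh_automaton A" and det: "deterministic A" and inj: "inj_on f (states A)"
  shows "deterministic (rename_states f A)"
  unfolding deterministic_def
proof (intro ballI)
  fix p a
  assume "p \<in> states (rename_states f A)" "a \<in> alphabet (rename_states f A)"
  then obtain q where q: "q \<in> states A" "p = f q" and a: "a \<in> alphabet A"
    by auto
  from det q(1) a obtain t where t: "t \<in> transitions A" "source t = q" "letter t = a"
    and uniq: "\<And>t'. t' \<in> transitions A \<Longrightarrow> source t' = q \<Longrightarrow> letter t' = a \<Longrightarrow> t' = t"
    unfolding deterministic_def by metis
  show "\<exists>!t. t \<in> transitions (rename_states f A) \<and> source t = p \<and> letter t = a"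
  proof (rule ex1I)
    show "rename_trans f t \<in> transitions (rename_states f A) \<and>
        source (rename_trans f t) = p \<and> letter (rename_trans f t) = a"
      using t q by simp
  next
    fix u
    assume u: "u \<in> transitions (rename_states f A) \<and> source u = p \<and> letter u = a"
    then obtain t' where t': "t' \<in> transitions A" "u = rename_trans f t'"
      by auto
    have "source t' = q"
      using u t' q inj parikh_automaton_transD(1)[OF A t'(1)] by (auto dest: inj_onD)
    then show "u = rename_trans f t"
      using uniq[of t'] u t' by simp
  qed
qed

lemma is_run_rename_states:
  assumes "is_run A \<alpha> r"
  shows "is_run (rename_states f A) \<alpha> (rename_trans f \<circ> r)"
  using assms by (auto simp: is_run_def)

lemma is_run_rename_statesE:
  assumes A: "parikh_automaton A" and inj: "inj_on f (states A)"
    and run: "is_run (rename_states f A) \<alpha> r"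
  obtains s where "is_run A \<alpha> s" "r = rename_trans f \<circ> s"
proof -
  have "\<forall>i. \<exists>t. t \<in> transitions A \<and> r i = rename_trans f t"
    using run unfolding is_run_def rename_states_sel by (metis imageE)
  then obtain s where s: "\<And>i. s i \<in> transitions A" "\<And>i. r i = rename_trans f (s i)"
    by metis
  note st = parikh_automaton_transD[OF A s(1)]
  have "source (s 0) = initial A"
    using run s(2) st A inj by (auto simp: is_run_def parikh_automaton_def dest: inj_onD)
  moreover have "source (s (Suc i)) = target (s i)" for i
  proof -
    have "f (source (s (Suc i))) = f (target (s i))"
      using run s(2) by (simp add: is_run_def)
    then show ?thesis
      using inj st by (auto dest: inj_onD)
  qed
  ultimately have "is_run A \<alpha> s"
    using run s by (auto simp: is_run_def)
  moreover have "r = rename_trans f \<circ> s"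
    using s(2) by auto
  ultimately show ?thesis
    using that by blast
qed

lemma state_at_rename [simp]: "state_at (rename_trans f \<circ> r) i = f (state_at r i)"
  by (cases i) (simp_all add: state_at_def)

lemma weight_rename [simp]: "weight (rename_trans f \<circ> r) m n = weight r m n"
  by (simp add: weight_def)

lemma state_at_in_states:
  assumes "parikh_automaton A" "is_run A \<alpha> r"
  shows "state_at r i \<in> states A"
  using assms parikh_automaton_transD[OF assms(1)]
  by (cases i) (auto simp: state_at_def is_run_def parikh_automaton_def)

lemma accepting_rename_iff:
  assumes A: "parikh_automaton A" and inj: "inj_on f (states A)" and run: "is_run A \<alpha> r"
  shows "f (state_at r i) \<in> f ` accepting A \<longleftrightarrow> state_at r i \<in> accepting A"
  using A inj state_at_in_states[OF A run]
  by (auto simp: parikh_automaton_def dest: inj_onD)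

lemma languages_rename_states:
  assumes A: "parikh_automaton A" and inj: "inj_on f (states A)"
  shows "reach_reg_language (rename_states f A) = reach_reg_language A"
    and "weak_reset_language (rename_states f A) = weak_reset_language A"
proof -
  have "reach_reg_accepting (rename_states f A) (rename_trans f \<circ> r) = reach_reg_accepting A r"
    and "weak_reset_accepting (rename_states f A) (rename_trans f \<circ> r) = weak_reset_accepting A r"
    if "is_run A \<alpha> r" for \<alpha> r
    using accepting_rename_iff[OF A inj that]
    by (simp_all add: reach_reg_accepting_def weak_reset_accepting_def)
  then show "reach_reg_language (rename_states f A) = reach_reg_language A"
    and "weak_reset_language (rename_states f A) = weak_reset_language A"
    unfolding reach_reg_language_def weak_reset_language_def
    by (auto intro: is_run_rename_states elim!: is_run_rename_statesE[OF A inj]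
      intro!: Collect_cong)
qed

lemma
  fixes A :: "('q, 'a) pa"
  assumes A: "parikh_automaton A" and det: "deterministic A"
  shows reach_reg_language_in_class: "reach_reg_language A \<in> det_reach_reg_languages"
    and weak_reset_language_in_class: "weak_reset_language A \<in> det_weak_reset_languages"
proof -
  obtain f :: "'q \<Rightarrow> nat" where inj: "inj_on f (states A)"
    using A finite_imp_inj_to_nat_seg unfolding parikh_automaton_def by metis
  note B = parikh_automaton_rename_states[OF A, of f] deterministic_rename_states[OF A det inj]
  show "reach_reg_language A \<in> det_reach_reg_languages"
    unfolding det_reach_reg_languages_def using B languages_rename_states[OF A inj] by blast
  show "weak_reset_language A \<in> det_weak_reset_languages"
    unfolding det_weak_reset_languages_def using B languages_rename_states[OF A inj] by blast
qed

end

theory Submission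
  imports Defs "HOL-Library.Infinite_Set"
begin

text \<open>
  Inclusion: a fresh initial state and one additional coordinate, which is 1 on the first transition
  of a run and 0 on all others, let the constraint set recognise the first reset interval. It imposes
  \<open>C\<close> on this interval and nothing on the later ones.

  Strictness: consider the words over \<open>{a, b}\<close> with infinitely many prefixes containing as many
  \<open>a\<close> as \<open>b\<close>. A reachability-regular automaton with \<open>N\<close> states for this language accepts
  \<open>(a\<^sup>N b\<^sup>N)\<^sup>\<omega>\<close>. In a block \<open>a\<^sup>N\<close> that comes after the position meeting the reachability condition
  the run has a loop; repeating it once preserves acceptance, but makes the number of \<open>a\<close> exceed the
  number of \<open>b\<close> in all longer prefixes.
\<close>

section \<open>Semilinear sets and runs\<close>

lemma vectorsD: "v \<in> vectors d \<Longrightarrow> d \<le> j \<Longrightarrow> v j = 0"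
  by (simp add: vectors_def)

lemma linear_set_subset_vectors:
  assumes "linear_set d L"
  shows "L \<subseteq> vectors d"
  using assms unfolding linear_set_def linear_comb_set_def vectors_def by fastforce

lemma semilinear_set_subset_vectors:
  assumes "semilinear_set d C"
  shows "C \<subseteq> vectors d"
  using assms linear_set_subset_vectors unfolding semilinear_set_def by blast

lemma semilinear_set_Un:
  assumes "semilinear_set d C" "semilinear_set d D"
  shows "semilinear_set d (C \<union> D)"
proof -
  obtain L M where "finite L" "\<forall>X\<in>L. linear_set d X" "C = \<Union>L"
    "finite M" "\<forall>X\<in>M. linear_set d X" "D = \<Union>M"
    using assms unfolding semilinear_set_def by metis
  then show ?thesis
    unfolding semilinear_set_def by (intro exI[of _ "L \<union> M"]) auto
qed

lemma linear_imp_semilinear_set: "linear_set d L \<Longrightarrow> semilinear_set d L"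
  unfolding semilinear_set_def by (intro exI[of _ "{L}"]) auto

text \<open>The first \<open>d\<close> unit vectors are the periods and zero is the base. The
  ambient dimension \<open>e\<close> is separate because \<open>reset_pa\<close> uses
  \<open>vectors d\<close> inside dimension \<open>Suc d\<close>, as the vectors whose tag is
  0.\<close>

lemma linear_set_vectors:
  assumes "d \<le> e"
  shows "linear_set e (vectors d)"
proof -
  define u :: "nat \<Rightarrow> vector" where "u i = (\<lambda>j. if j = i then 1 else 0)" for i
  have inj: "inj_on u {..<d}"
    by (rule inj_onI) (metis u_def zero_neq_one)
  have comb: "(\<Sum>p\<in>u ` {..<d}. p j * z p) = (if j < d then z (u j) else 0)" for z j
  proof -
    have "(\<Sum>p\<in>u ` {..<d}. p j * z p) = (\<Sum>i<d. u i j * z (u i))"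
      by (simp add: sum.reindex[OF inj])
    also have "\<dots> = (\<Sum>i<d. if i = j then z (u i) else 0)"
      by (intro sum.cong) (auto simp: u_def)
    finally show ?thesis
      by simp
  qed
  have "v \<in> linear_comb_set (\<lambda>_. 0) (u ` {..<d})" if "v \<in> vectors d" for v
  proof -
    \<comment> \<open>The coefficient of the \<open>i\<close>-th unit vector is \<open>v i\<close>;
      the index is recovered by inverting \<open>u\<close>.\<close>
    define z where "z p = v (inv_into {..<d} u p)" for p
    have "z (u j) = v j" if "j < d" for j
      using inv_into_f_f[OF inj, of j] that by (simp add: z_def)
    then have "v = (\<lambda>j. 0 + (\<Sum>p\<in>u ` {..<d}. p j * z p))"
      using vectorsD[OF that] by (auto simp: comb)
    then show ?thesis
      unfolding linear_comb_set_def by blast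
  qed
  moreover have "linear_comb_set (\<lambda>_. 0) (u ` {..<d}) \<subseteq> vectors d"
    by (auto simp: linear_comb_set_def comb vectors_def)
  ultimately have "vectors d = linear_comb_set (\<lambda>_. 0) (u ` {..<d})"
    by blast
  moreover have "u ` {..<d} \<subseteq> vectors e" "(\<lambda>_. 0) \<in> vectors e"
    using assms by (auto simp: vectors_def u_def)
  ultimately show ?thesis
    unfolding linear_set_def by blast
qed

text \<open>Only the base receives the 1: the periods vanish at index \<open>d\<close>, so no
  combination of them changes the tag.\<close>

lemma linear_set_tag:
  assumes "linear_set d L"
  shows "linear_set (Suc d) ((\<lambda>v. v(d := 1)) ` L)"
proof -
  obtain b P where b: "b \<in> vectors d" and P: "finite P" "P \<subseteq> vectors d"
    and L: "L = linear_comb_set b P"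
    using assms unfolding linear_set_def by blast
  have "(\<lambda>j. b j + (\<Sum>p\<in>P. p j * z p))(d := 1) =
      (\<lambda>j. (b(d := 1)) j + (\<Sum>p\<in>P. p j * z p))" for z
  proof -
    have "(\<Sum>p\<in>P. p d * z p) = 0"
      using P(2) by (intro sum.neutral) (auto simp: vectors_def)
    then show ?thesis
      by auto
  qed
  then have "(\<lambda>v. v(d := 1)) ` L = linear_comb_set (b(d := 1)) P"
    unfolding L linear_comb_set_def by (auto simp: image_iff) metis+
  moreover have "b(d := 1) \<in> vectors (Suc d)" "P \<subseteq> vectors (Suc d)"
    using b P(2) by (auto simp: vectors_def)
  ultimately show ?thesis
    using P(1) unfolding linear_set_def by blast
qed

lemma semilinear_set_tag:
  assumes "semilinear_set d C"
  shows "semilinear_set (Suc d) ((\<lambda>v. v(d := 1)) ` C)"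
proof -
  obtain M where "finite M" "\<forall>L\<in>M. linear_set d L" "C = \<Union>M"
    using assms unfolding semilinear_set_def by metis
  then show ?thesis
    unfolding semilinear_set_def
    by (intro exI[of _ "(`) (\<lambda>v. v(d := 1)) ` M"]) (auto simp: linear_set_tag[simplified])
qed

section \<open>Weights along runs and sequences of reset positions\<close>

lemma weight_in_vectors:
  assumes "parikh_automaton A" "is_run A \<alpha> r"
  shows "weight r m n \<in> vectors (dimension A)"
  using assms parikh_automaton_transD(3)[OF assms(1)]
  by (auto simp: is_run_def weight_def vectors_def)

lemma weight_add:
  assumes "l \<le> m" "m \<le> n"
  shows "weight r l n j = weight r l m j + weight r m n j"
  by (simp add: weight_def sum.atLeastLessThan_concat[OF assms])

lemma state_at_eq_source: "is_run A \<alpha> r \<Longrightarrow> state_at r i = source (r i)"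
  by (cases i) (simp_all add: state_at_def is_run_def)

lemma weak_reset_acceptingI:
  assumes "k 0 = 0" "strict_mono k"
    and "\<And>i. state_at r (k (Suc i)) \<in> accepting A"
    and "\<And>i. weight r (k i) (k (Suc i)) \<in> constraint_set A"
  shows "weak_reset_accepting A r"
  using assms unfolding weak_reset_accepting_def
  by (intro exI[of _ k]) (auto simp: Suc_le_eq gr0_conv_Suc)

lemma weak_reset_acceptingE:
  assumes "weak_reset_accepting A r"
  obtains k where "k 0 = 0" "strict_mono k"
    and "\<And>i. state_at r (k (Suc i)) \<in> accepting A"
    and "\<And>i. weight r (k i) (k (Suc i)) \<in> constraint_set A"
proof -
  obtain k :: "nat \<Rightarrow> nat" where k: "k 0 = 0" "strict_mono k"
    and acc: "\<forall>i\<ge>1. state_at r (k i) \<in> accepting A \<and>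
      weight r (k (i - 1)) (k i) \<in> constraint_set A"
    using assms unfolding weak_reset_accepting_def by blast
  show ?thesis
  proof (rule that[OF k])
    fix i
    show "state_at r (k (Suc i)) \<in> accepting A"
      "weight r (k i) (k (Suc i)) \<in> constraint_set A"
      using acc[rule_format, of "Suc i"] by simp_all
  qed
qed


section \<open>Weak reset automata simulate reachability-regular automata\<close>

text \<open>Index \<open>d\<close> is the first one beyond the coordinates of a
  \<open>d\<close>-dimensional label, hence free for the tag.\<close>

definition first_trans :: "nat \<Rightarrow> ('q, 'a) transition \<Rightarrow> ('q option, 'a) transition" where
  "first_trans d t = (None, letter t, (label_vec t)(d := 1), Some (target t))"

lemma first_trans_sel [simp]:
  "source (first_trans d t) = None"
  "letter (first_trans d t) = letter t"
  "label_vec (first_trans d t) = (label_vec t)(d := 1)"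
  "target (first_trans d t) = Some (target t)"
  by (simp_all add: first_trans_def)

text \<open>The original transitions out of \<open>initial A\<close> are kept, since a run may
  return to that state later. The two parts of the constraint set differ in the coordinate
  \<open>dimension A\<close>: 0 for intervals without the first transition, 1 for the one containing
  it.\<close>

definition reset_pa :: "('q, 'a) pa \<Rightarrow> ('q option, 'a) pa" where
  "reset_pa A =
    \<lparr>dimension = Suc (dimension A), states = insert None (Some ` states A), alphabet = alphabet A,
     initial = None,
     transitions = rename_trans Some ` transitions A \<union>
       first_trans (dimension A) ` {t \<in> transitions A. source t = initial A},
     accepting = Some ` accepting A,
     constraint_set =
       vectors (dimension A) \<union> (\<lambda>v. v(dimension A := 1)) ` constraint_set A\<rparr>"

lemma reset_pa_sel [simp]:
  "dimension (reset_pa A) = Suc (dimension A)"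
  "states (reset_pa A) = insert None (Some ` states A)"
  "alphabet (reset_pa A) = alphabet A"
  "initial (reset_pa A) = None"
  "transitions (reset_pa A) = rename_trans Some ` transitions A \<union>
    first_trans (dimension A) ` {t \<in> transitions A. source t = initial A}"
  "accepting (reset_pa A) = Some ` accepting A"
  "constraint_set (reset_pa A) =
    vectors (dimension A) \<union> (\<lambda>v. v(dimension A := 1)) ` constraint_set A"
  by (simp_all add: reset_pa_def)

lemma parikh_automaton_reset_pa:
  assumes A: "parikh_automaton A"
  shows "parikh_automaton (reset_pa A)"
proof -
  have "semilinear_set (dimension A) (constraint_set A)"
    using A by (simp add: parikh_automaton_def)
  then have "semilinear_set (dimension (reset_pa A)) (constraint_set (reset_pa A))"
    using linear_imp_semilinear_set[OF linear_set_vectors[of "dimension A" "Suc (dimension A)"]]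
    unfolding reset_pa_sel by (intro semilinear_set_Un semilinear_set_tag) simp_all
  moreover have "transitions (reset_pa A) \<subseteq>
      states (reset_pa A) \<times> alphabet (reset_pa A) \<times> vectors (dimension (reset_pa A)) \<times>
      states (reset_pa A)"
    using parikh_automaton_transD[OF A]
    by (auto simp: rename_trans_def first_trans_def vectors_def)
  ultimately show ?thesis
    using A by (auto simp: parikh_automaton_def)
qed

lemma deterministic_reset_pa:
  assumes A: "parikh_automaton A" and det: "deterministic A"
  shows "deterministic (reset_pa A)"
  unfolding deterministic_def
proof (intro ballI)
  fix p x
  assume p: "p \<in> states (reset_pa A)" and x: "x \<in> alphabet (reset_pa A)"
  \<comment> \<open>\<open>None\<close> acts as a copy of \<open>initial A\<close>, so in both cases
    the unique transition comes from the one of \<open>A\<close> at \<open>q\<close>.\<close>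
  define q where "q = (case p of None \<Rightarrow> initial A | Some q \<Rightarrow> q)"
  have "q \<in> states A" "x \<in> alphabet A"
    using p x A by (auto simp: q_def parikh_automaton_def)
  then obtain t where t: "t \<in> transitions A" "source t = q" "letter t = x"
    and uniq: "\<And>t'. t' \<in> transitions A \<Longrightarrow> source t' = q \<Longrightarrow> letter t' = x \<Longrightarrow> t' = t"
    using det unfolding deterministic_def by metis
  show "\<exists>!t. t \<in> transitions (reset_pa A) \<and> source t = p \<and> letter t = x"
  proof (cases p)
    case None
    show ?thesis
    proof (rule ex1I)
      show "first_trans (dimension A) t \<in> transitions (reset_pa A) \<and>
          source (first_trans (dimension A) t) = p \<and> letter (first_trans (dimension A) t) = x"
        using None t by (simp add: q_def)
    next
      fix u
      assume u: "u \<in> transitions (reset_pa A) \<and> source u = p \<and> letter u = x"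
      then obtain t' where "t' \<in> transitions A" "source t' = initial A"
        "u = first_trans (dimension A) t'"
        using None by auto
      then show "u = first_trans (dimension A) t"
        using uniq[of t'] u None by (simp add: q_def)
    qed
  next
    case (Some q')
    show ?thesis
    proof (rule ex1I)
      show "rename_trans Some t \<in> transitions (reset_pa A) \<and>
          source (rename_trans Some t) = p \<and> letter (rename_trans Some t) = x"
        using Some t by (simp add: q_def)
    next
      fix u
      assume u: "u \<in> transitions (reset_pa A) \<and> source u = p \<and> letter u = x"
      then obtain t' where "t' \<in> transitions A" "u = rename_trans Some t'"
        using Some by auto
      then show "u = rename_trans Some t"
        using uniq[of t'] u Some by (simp add: q_def)
    qed
  qed
qed

section \<open>Correspondence between runs of \<open>A\<close> and runs of
  \<open>reset_pa A\<close>\<close>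

definition lift_run ::
    "nat \<Rightarrow> (nat \<Rightarrow> ('q, 'a) transition) \<Rightarrow> nat \<Rightarrow> ('q option, 'a) transition" where
  "lift_run d r i = (if i = 0 then first_trans d (r i) else rename_trans Some (r i))"

lemma is_run_lift_run:
  assumes "is_run A \<alpha> r"
  shows "is_run (reset_pa A) \<alpha> (lift_run (dimension A) r)"
  using assms by (auto simp: is_run_def lift_run_def)

lemma is_run_reset_paE:
  assumes run: "is_run (reset_pa A) \<alpha> s"
  obtains r where "is_run A \<alpha> r" "s = lift_run (dimension A) r"
proof -
  have tr: "s i \<in> transitions (reset_pa A)" for i
    using run by (simp add: is_run_def)
  \<comment> \<open>Every target has the form \<open>Some q\<close>, so \<open>None\<close> is
    visited only at position 0. This decides which of the two kinds of transition each
    \<open>s i\<close> is.\<close>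
  have none: "source (s i) = None \<longleftrightarrow> i = 0" for i
  proof (cases i)
    case 0
    then show ?thesis
      using run by (simp add: is_run_def)
  next
    case (Suc j)
    have "target (s j) \<noteq> None"
      using tr[of j] by auto
    then show ?thesis
      using run Suc by (simp add: is_run_def)
  qed
  have ex: "\<forall>i. \<exists>t. t \<in> transitions A \<and> (i = 0 \<longrightarrow> source t = initial A) \<and>
      s i = (if i = 0 then first_trans (dimension A) t else rename_trans Some t)"
  proof
    fix i
    obtain t where "t \<in> transitions A"
      "s i = rename_trans Some t \<or> s i = first_trans (dimension A) t \<and> source t = initial A"
      using tr[of i] unfolding reset_pa_sel by blast
    then show "\<exists>t. t \<in> transitions A \<and> (i = 0 \<longrightarrow> source t = initial A) \<and>
        s i = (if i = 0 then first_trans (dimension A) t else rename_trans Some t)"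
      using none[of i] by (intro exI[of _ t]) auto
  qed
  from choice[OF ex] obtain r where
    r: "\<forall>i. r i \<in> transitions A \<and> (i = 0 \<longrightarrow> source (r i) = initial A) \<and>
      s i = (if i = 0 then first_trans (dimension A) (r i) else rename_trans Some (r i))"
    by (rule exE)
  then have s: "s = lift_run (dimension A) r"
    by (auto simp: lift_run_def)
  have "letter (r i) = \<alpha> i" for i
    using run by (cases i) (auto simp: s is_run_def lift_run_def split: if_splits)
  moreover have "source (r (Suc i)) = target (r i)" for i
  proof -
    have "source (s (Suc i)) = target (s i)"
      using run by (simp add: is_run_def)
    then show ?thesis
      by (cases i) (simp_all add: s lift_run_def)
  qed
  ultimately have "is_run A \<alpha> r"
    using r by (simp add: is_run_def)
  then show ?thesis
    using s that by blast
qed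

lemma state_at_lift_run:
  "0 < i \<Longrightarrow> state_at (lift_run d r) i = Some (state_at r i)"
  by (cases i) (simp_all add: state_at_def lift_run_def)

lemma weight_lift_run:
  assumes "0 < m"
  shows "weight (lift_run d r) m n = weight r m n"
  using assms unfolding weight_def
  by (intro ext sum.cong) (auto simp: lift_run_def)

text \<open>The tag of the sum is exactly 1: the first transition contributes 1, and all labels of
  \<open>A\<close> vanish at index \<open>dimension A\<close>.\<close>

lemma weight_lift_run_0:
  assumes A: "parikh_automaton A" and run: "is_run A \<alpha> r" and "0 < n"
  shows "weight (lift_run (dimension A) r) 0 n = (weight r 0 n)(dimension A := 1)"
proof
  fix j
  have "weight (lift_run (dimension A) r) 0 n j =
      weight (lift_run (dimension A) r) 0 1 j + weight r 1 n j"
    using weight_add[of 0 1 n "lift_run (dimension A) r" j] \<open>0 < n\<close>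
    by (simp add: weight_lift_run)
  moreover have "weight (lift_run (dimension A) r) 0 1 j = ((weight r 0 1)(dimension A := 1)) j"
    by (simp add: weight_def lift_run_def)
  moreover have "weight r 0 n j = weight r 0 1 j + weight r 1 n j"
    using weight_add[of 0 1 n r j] \<open>0 < n\<close> by simp
  moreover have "weight r 1 n (dimension A) = 0"
    using vectorsD[OF weight_in_vectors[OF A run]] by simp
  ultimately show
    "weight (lift_run (dimension A) r) 0 n j = ((weight r 0 n)(dimension A := 1)) j"
    by simp
qed

text \<open>Tagging moves \<open>v\<close> out of \<open>vectors (dimension A)\<close>, and it is
  injective on vectors of that dimension because the overwritten entry is always 0.\<close>

lemma tag_in_constraint_set_reset_pa:
  assumes A: "parikh_automaton A" and v: "v \<in> vectors (dimension A)"
  shows "v(dimension A := 1) \<in> constraint_set (reset_pa A) \<longleftrightarrow> v \<in> constraint_set A"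
proof -
  have "v(dimension A := 1) \<notin> vectors (dimension A)"
    using vectorsD[of "v(dimension A := 1)"] by fastforce
  moreover have "v = w"
    if "w \<in> constraint_set A" "v(dimension A := 1) = w(dimension A := 1)" for w
  proof -
    have "w (dimension A) = v (dimension A)"
      using that(1) v A semilinear_set_subset_vectors vectorsD
      unfolding parikh_automaton_def by (metis order_refl subsetD)
    then show ?thesis
      using that(2) by (metis fun_upd_triv fun_upd_upd)
  qed
  ultimately show ?thesis
    by auto
qed

lemma weak_reset_accepting_lift_run:
  assumes A: "parikh_automaton A" and run: "is_run A \<alpha> r"
  shows "weak_reset_accepting (reset_pa A) (lift_run (dimension A) r) \<longleftrightarrow>
    reach_reg_accepting A r" (is "?W \<longleftrightarrow> ?R")
proof
  assume ?W
  then obtain k where k: "k 0 = 0" "strict_mono k"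
    and acc: "\<And>i. state_at (lift_run (dimension A) r) (k (Suc i)) \<in> accepting (reset_pa A)"
    and con: "\<And>i.
      weight (lift_run (dimension A) r) (k i) (k (Suc i)) \<in> constraint_set (reset_pa A)"
    by (rule weak_reset_acceptingE) blast
  have pos: "0 < k (Suc i)" for i
    using k by (metis strict_monoD zero_less_Suc)
  have acc': "state_at r (k (Suc i)) \<in> accepting A" for i
    using acc[of i] pos[of i] by (auto simp: state_at_lift_run)
  \<comment> \<open>The first interval is non-empty and starts at 0, so its weight is tagged and has
    to satisfy the constraint of \<open>A\<close>; its end is the position required for
    reachability.\<close>
  have init: "weight r 0 (k (Suc 0)) \<in> constraint_set A"
    using con[of 0] pos[of 0]
    by (simp only: k(1) weight_lift_run_0[OF A run]
      tag_in_constraint_set_reset_pa[OF A weight_in_vectors[OF A run]])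
  have "inj (\<lambda>i. k (Suc i))"
    using k(2) by (auto simp: inj_on_def strict_mono_eq)
  moreover have "range (\<lambda>i. k (Suc i)) \<subseteq> {j. 1 \<le> j \<and> state_at r j \<in> accepting A}"
    using acc' pos by (auto simp: Suc_le_eq)
  ultimately have "infinite {j. 1 \<le> j \<and> state_at r j \<in> accepting A}"
    by (meson finite_subset range_inj_infinite)
  with init show ?R
    using acc'[of 0] pos[of 0] unfolding reach_reg_accepting_def
    by (intro conjI exI[of _ "k (Suc 0)"]) simp_all
next
  assume ?R
  then obtain i where i: "1 \<le> i" "state_at r i \<in> accepting A" "weight r 0 i \<in> constraint_set A"
    and inf: "infinite {j. 1 \<le> j \<and> state_at r j \<in> accepting A}"
    unfolding reach_reg_accepting_def by blast
  \<comment> \<open>Accepting positions before \<open>i\<close> are dropped, so that the first reset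
    takes place at \<open>i\<close>, where the constraint of \<open>A\<close> holds. All later
    accepting positions become resets as well.\<close>
  define S where "S = {j. i \<le> j \<and> state_at r j \<in> accepting A}"
  have "{j. 1 \<le> j \<and> state_at r j \<in> accepting A} \<subseteq> S \<union> {..<i}"
    by (auto simp: S_def)
  then have infS: "infinite S"
    using inf by (meson finite_Un finite_lessThan finite_subset)
  define k where "k n = (case n of 0 \<Rightarrow> 0 | Suc m \<Rightarrow> enumerate S m)" for n
  have k: "i \<le> k (Suc n)" "state_at r (k (Suc n)) \<in> accepting A" for n
    using enumerate_in_set[OF infS, of n] by (auto simp: S_def k_def)
  have k1: "k (Suc 0) = i"
    using i(2) by (auto simp: k_def enumerate_0 S_def intro!: Least_equality)
  have "k n < k (Suc n)" for n
    using enumerate_mono[OF _ infS] k(1)[of n] i(1) by (cases n) (auto simp: k_def)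
  then have "strict_mono k"
    by (simp add: strict_mono_Suc_iff)
  moreover have "state_at (lift_run (dimension A) r) (k (Suc n)) \<in> accepting (reset_pa A)" for n
    using k[of n] i(1) by (simp add: state_at_lift_run)
  moreover have "weight (lift_run (dimension A) r) (k n) (k (Suc n)) \<in> constraint_set (reset_pa A)"
    for n
  proof (cases n)
    case 0
    then show ?thesis
      using k1 i weight_lift_run_0[OF A run, of i] by (auto simp: k_def)
  next
    \<comment> \<open>The interval starts at a positive position, so its weight is untagged and lies
      in \<open>vectors (dimension A)\<close>.\<close>
    case (Suc m)
    then show ?thesis
      using k(1)[of m] i(1) weight_in_vectors[OF A run] by (simp add: weight_lift_run)
  qed
  moreover have "k 0 = 0"
    by (simp add: k_def)
  ultimately show ?W
    by (intro weak_reset_acceptingI)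
qed

lemma weak_reset_language_reset_pa:
  assumes A: "parikh_automaton A"
  shows "weak_reset_language (reset_pa A) = reach_reg_language A"
proof -
  have "(\<exists>s. is_run (reset_pa A) \<alpha> s \<and> weak_reset_accepting (reset_pa A) s) \<longleftrightarrow>
      (\<exists>r. is_run A \<alpha> r \<and> reach_reg_accepting A r)" for \<alpha>
    using is_run_lift_run weak_reset_accepting_lift_run[OF A] by (blast elim: is_run_reset_paE)
  then show ?thesis
    by (simp add: weak_reset_language_def reach_reg_language_def)
qed

lemma det_reach_reg_subset_det_weak_reset:
  "(det_reach_reg_languages :: (nat \<Rightarrow> 'a) set set) \<subseteq> det_weak_reset_languages"
proof
  fix L :: "(nat \<Rightarrow> 'a) set"
  assume "L \<in> det_reach_reg_languages"
  then obtain A :: "(nat, 'a) pa" where A: "parikh_automaton A" "deterministic A"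
    and L: "L = reach_reg_language A"
    unfolding det_reach_reg_languages_def by blast
  have "weak_reset_language (reset_pa A) \<in> det_weak_reset_languages"
    using A by (intro weak_reset_language_in_class parikh_automaton_reset_pa deterministic_reset_pa)
  then show "L \<in> det_weak_reset_languages"
    by (simp add: L weak_reset_language_reset_pa[OF A(1)])
qed


section \<open>Words with infinitely many balanced prefixes\<close>

text \<open>Every letter other than \<open>a\<close> counts as -1; on words over
  \<open>{a, b}\<close> with \<open>a\<close> and \<open>b\<close> distinct this is the number of
  \<open>a\<close> minus the number of \<open>b\<close> in the prefix of length
  \<open>n\<close>.\<close>

definition excess :: "'a \<Rightarrow> (nat \<Rightarrow> 'a) \<Rightarrow> nat \<Rightarrow> int" where
  "excess a \<alpha> n = (\<Sum>i<n. if \<alpha> i = a then 1 else - 1)"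

lemma excess_0 [simp]: "excess a \<alpha> 0 = 0"
  and excess_Suc: "excess a \<alpha> (Suc n) = excess a \<alpha> n + (if \<alpha> n = a then 1 else - 1)"
  by (simp_all add: excess_def)

definition balanced_language :: "'a \<Rightarrow> 'a \<Rightarrow> (nat \<Rightarrow> 'a) set" where
  "balanced_language a b = {\<alpha>. range \<alpha> \<subseteq> {a, b} \<and> infinite {n. excess a \<alpha> n = 0}}"

definition count_vec :: "'a \<Rightarrow> 'a \<Rightarrow> vector" where
  "count_vec a x = (\<lambda>j. if j = (if x = a then 0 else 1) then 1 else 0)"

text \<open>With a single, accepting state every position is accepting, and acceptance depends on
  the weights alone.\<close>

definition balanced_pa :: "'a \<Rightarrow> 'a \<Rightarrow> (nat, 'a) pa" where
  "balanced_pa a b =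
    \<lparr>dimension = 2, states = {0}, alphabet = {a, b}, initial = 0,
     transitions = (\<lambda>x. (0, x, count_vec a x, 0)) ` {a, b}, accepting = {0},
     constraint_set = {v \<in> vectors 2. v 0 = v 1}\<rparr>"

lemma balanced_pa_sel [simp]:
  "dimension (balanced_pa a b) = 2"
  "states (balanced_pa a b) = {0}"
  "alphabet (balanced_pa a b) = {a, b}"
  "initial (balanced_pa a b) = 0"
  "transitions (balanced_pa a b) = (\<lambda>x. (0, x, count_vec a x, 0)) ` {a, b}"
  "accepting (balanced_pa a b) = {0}"
  "constraint_set (balanced_pa a b) = {v \<in> vectors 2. v 0 = v 1}"
  by (simp_all add: balanced_pa_def)

text \<open>The diagonal is generated from zero by the single period (1, 1).\<close>

lemma linear_set_diagonal: "linear_set 2 {v \<in> vectors 2. v 0 = v 1}"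
proof -
  define u :: vector where "u = (\<lambda>j. if j < 2 then 1 else 0)"
  have "v \<in> linear_comb_set (\<lambda>_. 0) {u}" if "v \<in> vectors 2" "v 0 = v 1" for v
  proof -
    have eq: "v j = u j * v 0" for j
    proof -
      consider "j = 0" | "j = 1" | "2 \<le> j"
        by linarith
      then show ?thesis
        using that(2) vectorsD[OF that(1), of j] by cases (simp_all add: u_def)
    qed
    have "v = (\<lambda>j. 0 + (\<Sum>p\<in>{u}. p j * v 0))"
      by (intro ext) (simp flip: eq)
    then show ?thesis
      unfolding linear_comb_set_def mem_Collect_eq by (intro exI[of _ "\<lambda>_. v 0"]) simp
  qed
  then have "{v \<in> vectors 2. v 0 = v 1} = linear_comb_set (\<lambda>_. 0) {u}"
    by (auto simp: linear_comb_set_def u_def vectors_def)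
  moreover have "(\<lambda>_. 0) \<in> vectors 2" "{u} \<subseteq> vectors 2"
    by (auto simp: vectors_def u_def)
  ultimately show ?thesis
    unfolding linear_set_def by blast
qed

lemma parikh_automaton_balanced_pa: "parikh_automaton (balanced_pa a b)"
  using linear_imp_semilinear_set[OF linear_set_diagonal]
  by (auto simp: parikh_automaton_def count_vec_def vectors_def)

lemma deterministic_balanced_pa: "deterministic (balanced_pa a b)"
  by (auto simp: deterministic_def)

lemma is_run_balanced_pa:
  "is_run (balanced_pa a b) \<alpha> r \<longleftrightarrow>
    range \<alpha> \<subseteq> {a, b} \<and> r = (\<lambda>i. (0, \<alpha> i, count_vec a (\<alpha> i), 0))"
proof
  assume run: "is_run (balanced_pa a b) \<alpha> r"
  have "r i = (0, \<alpha> i, count_vec a (\<alpha> i), 0) \<and> \<alpha> i \<in> {a, b}" for i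
  proof -
    have "r i \<in> transitions (balanced_pa a b)" "letter (r i) = \<alpha> i"
      using run by (simp_all add: is_run_def)
    then show ?thesis
      by auto
  qed
  then show "range \<alpha> \<subseteq> {a, b} \<and> r = (\<lambda>i. (0, \<alpha> i, count_vec a (\<alpha> i), 0))"
    by auto
next
  assume \<alpha>: "range \<alpha> \<subseteq> {a, b} \<and> r = (\<lambda>i. (0, \<alpha> i, count_vec a (\<alpha> i), 0))"
  have "r i \<in> transitions (balanced_pa a b)" for i
    unfolding balanced_pa_sel using \<alpha> by (intro image_eqI[of _ _ "\<alpha> i"]) auto
  then show "is_run (balanced_pa a b) \<alpha> r"
    using \<alpha> by (simp add: is_run_def del: balanced_pa_sel(5))
qed

text \<open>The first coordinate of the weight minus the second is the growth of the excess between
  \<open>m\<close> and \<open>n\<close>.\<close>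

lemma weight_balanced_pa:
  assumes run: "is_run (balanced_pa a b) \<alpha> r" and "m \<le> n"
  shows "weight r m n \<in> constraint_set (balanced_pa a b) \<longleftrightarrow> excess a \<alpha> m = excess a \<alpha> n"
proof -
  have r: "label_vec (r i) = count_vec a (\<alpha> i)" for i
    using run by (simp add: is_run_balanced_pa)
  have "int (weight r m n 0) - int (weight r m n 1) = excess a \<alpha> n - excess a \<alpha> m"
    using \<open>m \<le> n\<close>
    by (induction n rule: dec_induct) (auto simp: weight_def r count_vec_def excess_Suc)
  moreover have "weight r m n \<in> vectors 2"
    using weight_in_vectors[OF parikh_automaton_balanced_pa run] by simp
  ultimately show ?thesis
    by auto
qed

lemma weak_reset_language_balanced_pa:
  "weak_reset_language (balanced_pa a b) = balanced_language a b"
proof -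
  have acc_iff: "weak_reset_accepting (balanced_pa a b) r \<longleftrightarrow> infinite {n. excess a \<alpha> n = 0}"
    (is "?W \<longleftrightarrow> infinite ?S") if run: "is_run (balanced_pa a b) \<alpha> r" for \<alpha> r
  proof
    assume ?W
    then obtain k where k: "k 0 = 0" "strict_mono k"
      and con: "\<And>i. weight r (k i) (k (Suc i)) \<in> constraint_set (balanced_pa a b)"
      by (rule weak_reset_acceptingE) blast
    \<comment> \<open>The excess is the same at consecutive reset positions and starts at 0.\<close>
    have "excess a \<alpha> (k i) = 0" for i
    proof (induction i)
      case 0
      then show ?case
        by (simp add: k(1))
    next
      case (Suc i)
      have "k i \<le> k (Suc i)"
        using k(2) by (simp add: strict_mono_less_eq)
      then show ?case
        using con[of i] Suc weight_balanced_pa[OF run, of "k i" "k (Suc i)"]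
        by simp
    qed
    then have "range k \<subseteq> ?S"
      by auto
    then show "infinite ?S"
      using k(2) by (meson finite_subset range_inj_infinite strict_mono_imp_inj_on)
  next
    assume inf: "infinite ?S"
    define k where "k = enumerate ?S"
    have k: "strict_mono k"
      unfolding k_def by (rule strict_mono_enumerate[OF inf])
    have ex: "excess a \<alpha> (k i) = 0" for i
      using enumerate_in_set[OF inf, of i] by (simp add: k_def)
    have "weight r (k i) (k (Suc i)) \<in> constraint_set (balanced_pa a b)" for i
      using k ex weight_balanced_pa[OF run, of "k i" "k (Suc i)"]
      by (simp add: strict_mono_less_eq)
    moreover have "state_at r i \<in> accepting (balanced_pa a b)" for i
      using state_at_in_states[OF parikh_automaton_balanced_pa run] by simp
    \<comment> \<open>The empty prefix is balanced, so the enumeration of all balanced positions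
      starts with 0, as a reset sequence must.\<close>
    moreover have "k 0 = 0"
      by (auto simp: k_def enumerate_0 intro!: Least_equality)
    ultimately show ?W
      using k by (intro weak_reset_acceptingI)
  qed
  have alph: "(\<forall>i. \<alpha> i \<in> alphabet (balanced_pa a b)) \<longleftrightarrow> range \<alpha> \<subseteq> {a, b}" for \<alpha>
    by auto
  have "(\<exists>r. is_run (balanced_pa a b) \<alpha> r \<and> weak_reset_accepting (balanced_pa a b) r) \<longleftrightarrow>
      range \<alpha> \<subseteq> {a, b} \<and> infinite {n. excess a \<alpha> n = 0}" for \<alpha>
    using acc_iff[of \<alpha>] by (auto simp: is_run_balanced_pa)
  then show ?thesis
    unfolding weak_reset_language_def balanced_language_def alph by auto
qed

section \<open>Pumping the block word\<close>

lemma excess_block_word: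
  assumes "a \<noteq> b" "0 < N"
  shows "excess a (\<lambda>i. if i mod (2 * N) < N then a else b) n =
    min (int (n mod (2 * N))) (int (2 * N) - int (n mod (2 * N)))"
proof (induction n)
  case (Suc n)
  \<comment> \<open>The excess is a zigzag of period \<open>2 * N\<close>: \<open>min\<close>
    selects the rising branch up to height \<open>N\<close>, then the falling one. The bound leaves
    only a step within a period or the wrap-around to 0.\<close>
  have "n mod (2 * N) < 2 * N"
    using assms(2) by simp
  then show ?case
    using Suc assms by (auto simp: excess_Suc mod_Suc)
qed (use assms in simp)

lemma reach_reg_language_neq_balanced_language:
  assumes A: "parikh_automaton A" and "a \<noteq> b"
  shows "reach_reg_language A \<noteq> balanced_language a b"
proof
  assume eq: "reach_reg_language A = balanced_language a b"
  define N where "N = card (states A)"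
  have N: "0 < N"
    using A unfolding N_def parikh_automaton_def by (auto simp: card_gt_0_iff)
  define \<alpha> where "\<alpha> i = (if i mod (2 * N) < N then a else b)" for i
  have ex: "excess a \<alpha> n = min (int (n mod (2 * N))) (int (2 * N) - int (n mod (2 * N)))" for n
    unfolding \<alpha>_def by (rule excess_block_word[OF \<open>a \<noteq> b\<close> N])
  have nonneg: "0 \<le> excess a \<alpha> n" for n
  proof -
    have "n mod (2 * N) < 2 * N"
      using N by simp
    then show ?thesis
      unfolding ex by linarith
  qed
  have "range (\<lambda>n. n * (2 * N)) \<subseteq> {n. excess a \<alpha> n = 0}"
    by (auto simp: ex)
  moreover have "inj (\<lambda>n. n * (2 * N))"
    using N by (auto simp: inj_on_def)
  ultimately have "infinite {n. excess a \<alpha> n = 0}"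
    by (meson finite_subset range_inj_infinite)
  then have "\<alpha> \<in> reach_reg_language A"
    unfolding eq balanced_language_def by (auto simp: \<alpha>_def)
  then obtain r where alph: "\<And>i. \<alpha> i \<in> alphabet A" and run: "is_run A \<alpha> r"
    and acc: "reach_reg_accepting A r"
    unfolding reach_reg_language_def by auto
  obtain i where i: "1 \<le> i" "state_at r i \<in> accepting A" "weight r 0 i \<in> constraint_set A"
    and inf: "infinite {j. 1 \<le> j \<and> state_at r j \<in> accepting A}"
    using acc unfolding reach_reg_accepting_def by blast

  \<comment> \<open>These are the \<open>N + 1\<close> positions around the block of
    \<open>a\<close> in period \<open>i\<close>, one more than there are states. As \<open>N\<close>
    is positive, none of them is before \<open>i\<close>.\<close>
  define B where "B = {i * (2 * N)..i * (2 * N) + N}"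
  have "\<not> inj_on (state_at r) B"
  proof
    assume "inj_on (state_at r) B"
    then have "card B \<le> card (states A)"
      using state_at_in_states[OF A run] A
      by (intro card_inj_on_le[of "state_at r"]) (auto simp: parikh_automaton_def)
    then show False
      by (simp add: B_def N_def)
  qed
  then obtain s t where st: "s \<in> B" "t \<in> B" "s < t" "state_at r s = state_at r t"
    unfolding inj_on_def by (metis linorder_neqE_nat)
  define d where "d = t - s"
  have d: "0 < d" "s = t - d" "d \<le> t"
    using st by (auto simp: d_def)
  have ex_B: "excess a \<alpha> n = int n - int (i * (2 * N))" if "n \<in> B" for n
  proof -
    define m where "m = n - i * (2 * N)"
    have m: "n = i * (2 * N) + m" "m \<le> N"
      using that by (auto simp: B_def m_def)
    then have "n mod (2 * N) = m"
      using N by simp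
    then show ?thesis
      unfolding ex using m by simp
  qed
  \<comment> \<open>Both ends of the loop lie on the rising branch, so the loop reads
    \<open>d\<close> letters \<open>a\<close> and nothing else.\<close>
  have ex_t: "excess a \<alpha> t = excess a \<alpha> s + int d"
    using ex_B st d by simp
  have "i \<le> i * (2 * N)"
    using N by simp
  moreover have "i * (2 * N) \<le> t"
    using st(2) by (simp add: B_def)
  ultimately have it: "i \<le> t"
    by (rule le_trans)

  \<comment> \<open>\<open>h\<close> maps positions of the pumped word to positions of the original
    one: from \<open>t\<close> on it falls back by \<open>d\<close> to \<open>s\<close>, so that the
    loop is read once more.\<close>
  define h where "h j = (if j < t then j else j - d)" for j
  have h_Suc: "h (Suc j) = Suc (h j)" if "Suc j \<noteq> t" for j
    using that d by (auto simp: h_def Suc_diff_le)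
  have run': "is_run A (\<alpha> \<circ> h) (r \<circ> h)"
  proof -
    have step: "source (r (Suc j)) = target (r j)" for j
      using run by (simp add: is_run_def)
    have "source (r (h (Suc j))) = target (r (h j))" for j
    \<comment> \<open>The only junction is at \<open>t\<close>, where \<open>h\<close> jumps to
      \<open>s\<close>; the run is in the same state at both positions.\<close>
    proof (cases "Suc j = t")
      case True
      then have "source (r (h (Suc j))) = state_at r s"
        using d by (simp add: h_def state_at_eq_source[OF run])
      also have "\<dots> = source (r (Suc j))"
        using st(4) True by (simp add: state_at_eq_source[OF run])
      also have "\<dots> = target (r (h j))"
        using True step[of j] by (auto simp: h_def)
      finally show ?thesis .
    qed (simp add: h_Suc step)
    moreover have "h 0 = 0"
      by (simp add: h_def)
    ultimately show ?thesis
      using run by (simp add: is_run_def)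
  qed
  have state': "state_at (r \<circ> h) j = state_at r (h j)" for j
    by (simp add: state_at_eq_source[OF run] state_at_eq_source[OF run'])
  \<comment> \<open>If \<open>i = t\<close>, then \<open>h i\<close> is \<open>s\<close> instead of
    \<open>i\<close>, but the states agree; otherwise \<open>h i = i\<close>.\<close>
  have "state_at (r \<circ> h) i = state_at r i"
    using it st(4) d(2) unfolding state' by (cases "i = t") (auto simp: h_def)
  moreover have "weight (r \<circ> h) 0 i = weight r 0 i"
    using it by (auto simp: weight_def h_def intro!: sum.cong)
  moreover have "infinite {j. 1 \<le> j \<and> state_at (r \<circ> h) j \<in> accepting A}"
  proof
    assume fin: "finite {j. 1 \<le> j \<and> state_at (r \<circ> h) j \<in> accepting A}"
    \<comment> \<open>An accepting position \<open>j\<close> with \<open>t \<le> j\<close> reappears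
      at \<open>j + d\<close> in the pumped run, so finitely many there would leave only finitely
      many in \<open>r\<close>.\<close>
    have "{j. 1 \<le> j \<and> state_at r j \<in> accepting A} \<subseteq>
        {..<t} \<union> (\<lambda>j. j - d) ` {j. 1 \<le> j \<and> state_at (r \<circ> h) j \<in> accepting A}"
    proof
      fix j
      assume j: "j \<in> {j. 1 \<le> j \<and> state_at r j \<in> accepting A}"
      have "h (j + d) = j" if "t \<le> j"
        using that by (simp add: h_def)
      then show "j \<in> {..<t} \<union> (\<lambda>j. j - d) ` {j. 1 \<le> j \<and> state_at (r \<circ> h) j \<in> accepting A}"
        using j by (cases "j < t") (auto simp: state' intro!: image_eqI[of _ _ "j + d"])
    qed
    then show False
      using inf fin by (meson finite_Un finite_imageI finite_lessThan finite_subset)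
  qed
  ultimately have "reach_reg_accepting A (r \<circ> h)"
    using i unfolding reach_reg_accepting_def by auto
  then have "\<alpha> \<circ> h \<in> balanced_language a b"
    using run' alph unfolding eq[symmetric] reach_reg_language_def by auto
  then have inf': "infinite {n. excess a (\<alpha> \<circ> h) n = 0}"
    by (simp add: balanced_language_def)

  have base_eq: "excess a (\<alpha> \<circ> h) t = excess a \<alpha> t"
    by (auto simp: excess_def h_def intro!: sum.cong)
  \<comment> \<open>The surplus of \<open>d\<close> from the repeated loop is never lost: after
    \<open>t\<close> the pumped word reads the letters of the original from \<open>s\<close>
    on.\<close>
  have "excess a (\<alpha> \<circ> h) n = excess a \<alpha> (n - d) + int d" if "t \<le> n" for n
    using that
  proof (induction n rule: dec_induct)
    case base
    then show ?case
      unfolding base_eq using ex_t d by simp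
  next
    case (step n)
    then show ?case
      using d by (simp add: excess_Suc Suc_diff_le h_def)
  qed
  \<comment> \<open>The original excess is never negative, so from \<open>t\<close> on the pumped
    word has excess at least \<open>d\<close>, which is positive.\<close>
  then have "n < t" if "excess a (\<alpha> \<circ> h) n = 0" for n
    using that nonneg[of "n - d"] d(1) by (cases "t \<le> n") simp_all
  then have "{n. excess a (\<alpha> \<circ> h) n = 0} \<subseteq> {..<t}"
    by auto
  then show False
    using inf' by (meson finite_lessThan finite_subset)
qed

theorem lemma16:
  shows "(det_reach_reg_languages :: (nat \<Rightarrow> 'a::infinite) set set) \<subset> det_weak_reset_languages"
proof -
  obtain a :: 'a where True
    by blast
  \<comment> \<open>Any letter serves as \<open>a\<close>; the infinite type supplies a second
    one.\<close>
  obtain b where "b \<noteq> a"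
    using ex_new_if_finite[OF infinite_UNIV, of "{a}"] by auto
  then have "balanced_language a b \<notin> det_reach_reg_languages"
    using reach_reg_language_neq_balanced_language[of _ a b]
    unfolding det_reach_reg_languages_def by force
  moreover have "balanced_language a b \<in> det_weak_reset_languages"
    using weak_reset_language_in_class[OF parikh_automaton_balanced_pa deterministic_balanced_pa]
    by (metis weak_reset_language_balanced_pa)
  ultimately show ?thesis
    using det_reach_reg_subset_det_weak_reset by blast
qed

end
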